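(* For lattices $\Lambda \subseteq \mathbb{R}^n$ with $n \geq 3$ and strictly convex and smooth norms $\Vert\cdot\Vert$ on $\mathbb{R}^n$, the number of Voronoi-relevant vectors of $\Lambda$ with respect to $\Vert\cdot\Vert$ cannot be bounded by a function depending only on $n$ and $\Vert\cdot\Vert$. That is, there is no function $f$ assigning to each pair $(n, \Vert\cdot\Vert)$, consisting of an integer $n \geq 3$ and a strictly convex and smooth norm $\Vert\cdot\Vert$ on $\mathbb{R}^n$, a real number $f(n,\Vert\cdot\Vert)$ such that for all such pairs every lattice $\Lambda \subseteq \mathbb{R}^n$ has at most $f(n,\Vert\cdot\Vert)$ Voronoi-relevant vectors with respect to $\Vert\cdot\Vert$.
   Context: A lattice $\Lambda \subseteq \mathbb{R}^n$ is a discrete additive subgroup of $\mathbb{R}^n$; all lattices are assumed to have full rank $n$, i.e. $\Lambda$ spans $\mathbb{R}^n$ over $\mathbb{R}$. A vector $v \in \Lambda \setminus \{0\}$ is Voronoi-relevant with respect to a norm $\Vert\cdot\Vert$ if there is some $x \in \mathbb{R}^n$ such that $\Vert x \Vert = \Vert x-v \Vert < \Vert x-w \Vert$ for all $w \in \Lambda \setminus \{0,v\}$. A norm is strictly convex if for all distinct $x,y \in \mathbb{R}^n$ with $\Vert x \Vert = \Vert y \Vert$ and all $\tau \in (0,1)$ we have $\Vert \tau x + (1-\tau) y \Vert < \Vert x \Vert$. A norm is smooth if each boundary point $p$ of its closed unit ball $K$ has a unique supporting hyperplane, i.e. a unique hyperplane $H$ through $p$ such that $K$ is contained in one of the two closed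 halfspaces bounded by $H$. *)

theory Defs
  imports "HOL-Analysis.Analysis" "HOL-Analysis.Finite_Function_Topology"
begin

text \<open>The dimension is quantified inside the statement, so real n-space is a set rather than a
  type: the finitely supported real sequences with support in \<open>{..<n}\<close>. The library makes
  finitely supported functions a real normed vector space under the sum of the absolute values
  of the coordinates, so the topology induced on this set is the standard one.\<close>

definition Rn :: "nat \<Rightarrow> (nat \<Rightarrow>\<^sub>0 real) set" where
  "Rn n = {x. Poly_Mapping.keys x \<subseteq> {..<n}}"

definition dot :: "nat \<Rightarrow> (nat \<Rightarrow>\<^sub>0 real) \<Rightarrow> (nat \<Rightarrow>\<^sub>0 real) \<Rightarrow> real" where
  "dot n x y = (\<Sum>i<n. Poly_Mapping.lookup x i * Poly_Mapping.lookup y i)"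

text \<open>Norms are total functions here; their values outside \<open>Rn n\<close> are never used.\<close>

definition norm_on :: "nat \<Rightarrow> ((nat \<Rightarrow>\<^sub>0 real) \<Rightarrow> real) \<Rightarrow> bool" where
  "norm_on n N \<longleftrightarrow>
     (\<forall>x\<in>Rn n. 0 \<le> N x) \<and>
     (\<forall>x\<in>Rn n. N x = 0 \<longleftrightarrow> x = 0) \<and>
     (\<forall>c. \<forall>x\<in>Rn n. N (c *\<^sub>R x) = \<bar>c\<bar> * N x) \<and>
     (\<forall>x\<in>Rn n. \<forall>y\<in>Rn n. N (x + y) \<le> N x + N y)"

definition strictly_convex_norm :: "nat \<Rightarrow> ((nat \<Rightarrow>\<^sub>0 real) \<Rightarrow> real) \<Rightarrow> bool" where
  "strictly_convex_norm n N \<longleftrightarrow> norm_on n N \<and>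
     (\<forall>x\<in>Rn n. \<forall>y\<in>Rn n. \<forall>\<tau>\<in>{0<..<1}.
        x \<noteq> y \<and> N x = N y \<longrightarrow> N (\<tau> *\<^sub>R x + (1 - \<tau>) *\<^sub>R y) < N x)"

definition supporting_hyperplane ::
    "nat \<Rightarrow> (nat \<Rightarrow>\<^sub>0 real) set \<Rightarrow> (nat \<Rightarrow>\<^sub>0 real) \<Rightarrow> (nat \<Rightarrow>\<^sub>0 real) set \<Rightarrow> bool" where
  "supporting_hyperplane n K p H \<longleftrightarrow>
     (\<exists>a c. a \<in> Rn n \<and> a \<noteq> 0 \<and> H = {x\<in>Rn n. dot n a x = c} \<and> p \<in> H \<and>
        (K \<subseteq> {x\<in>Rn n. dot n a x \<le> c} \<or> K \<subseteq> {x\<in>Rn n. dot n a x \<ge> c}))"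

text \<open>The boundary has to be taken relative to \<open>Rn n\<close>, which has empty interior in the
  ambient type.\<close>

definition smooth_norm :: "nat \<Rightarrow> ((nat \<Rightarrow>\<^sub>0 real) \<Rightarrow> real) \<Rightarrow> bool" where
  "smooth_norm n N \<longleftrightarrow> norm_on n N \<and>
     (let K = {x\<in>Rn n. N x \<le> 1} in
        \<forall>p \<in> top_of_set (Rn n) frontier_of K. \<exists>!H. supporting_hyperplane n K p H)"

definition full_rank_lattice :: "nat \<Rightarrow> (nat \<Rightarrow>\<^sub>0 real) set \<Rightarrow> bool" where
  "full_rank_lattice n \<Lambda> \<longleftrightarrow>
     0 \<in> \<Lambda> \<and> (\<forall>x\<in>\<Lambda>. \<forall>y\<in>\<Lambda>. x - y \<in> \<Lambda>) \<and> discrete \<Lambda> \<and> span \<Lambda> = Rn n"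

definition Voronoi_relevant ::
    "nat \<Rightarrow> ((nat \<Rightarrow>\<^sub>0 real) \<Rightarrow> real) \<Rightarrow> (nat \<Rightarrow>\<^sub>0 real) set \<Rightarrow> (nat \<Rightarrow>\<^sub>0 real) \<Rightarrow> bool" where
  "Voronoi_relevant n N \<Lambda> v \<longleftrightarrow> v \<in> \<Lambda> - {0} \<and>
     (\<exists>x\<in>Rn n. N x = N (x - v) \<and> (\<forall>w\<in>\<Lambda> - {0, v}. N (x - v) < N (x - w)))"

end

theory Submission
  imports Defs
begin

text \<open>One norm on three-space suffices: the sum \<open>N\<close> of the Euclidean lengths of \<open>(s, r, h)\<close> and
  \<open>(h - s, 2 r, h)\<close>, with the lattices \<open>(1/m)\<int> \<times> \<int> \<times> \<int>\<close> for large \<open>m\<close>. Since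
  \<open>N (-s, r, -h) = N (s, r, h)\<close>, every point \<open>(b/2m, r, 1/2)\<close> is equidistant from \<open>0\<close> and
  \<open>v = (b/m, 0, 1)\<close>. For fixed \<open>(r, h)\<close>, minimising \<open>N\<close> over \<open>s\<close> is the problem of light
  reflected in a line, so the minimiser \<open>s(r)\<close> is unique, the minimum grows with \<open>\<bar>r\<bar>\<close> and \<open>\<bar>h\<bar>\<close>, and for
  \<open>h = 1/2\<close> the minimiser really varies with \<open>r\<close>. If \<open>b/2m = s(r)\<close> for some \<open>0 \<le> r \<le> 1/4\<close>, then no
  lattice point besides \<open>0\<close> and \<open>v\<close> is as close to \<open>(b/2m, r, 1/2)\<close>, and \<open>v\<close> is Voronoi-relevant. The
  values \<open>s(r)\<close> fill an interval, so the number of such \<open>b\<close> grows linearly in \<open>m\<close>.\<close>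

section \<open>Coordinates and linear functionals on \<open>Rn n\<close>\<close>

lemma lookup_scaleR [simp]:
  "Poly_Mapping.lookup (c *\<^sub>R x) i = c *\<^sub>R Poly_Mapping.lookup x i"
proof -
  have "finite {i. c *\<^sub>R Poly_Mapping.lookup x i \<noteq> 0}"
    by (rule finite_subset[OF _ finite_lookup[of x]]) auto
  then show ?thesis
    by (simp add: scaleR_poly_mapping_def)
qed

lemma norm_lookup_le: "norm (Poly_Mapping.lookup x i) \<le> norm x"
proof (cases "i \<in> Poly_Mapping.keys x")
  case True
  then show ?thesis
    by (simp add: norm_poly_mapping_def dist_poly_mapping_def
        member_le_sum[where f = "\<lambda>i. norm (Poly_Mapping.lookup x i)"])
next
  case False
  then show ?thesis
    by (simp add: in_keys_iff)
qed

lemma bounded_linear_lookup: "bounded_linear (\<lambda>x. Poly_Mapping.lookup x i)"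
  by (rule bounded_linear_intro[where K = 1]) (auto simp: lookup_add norm_lookup_le)

lemma Rn_eq: "Rn n = {x. \<forall>i\<ge>n. Poly_Mapping.lookup x i = 0}"
  by (auto simp: Rn_def in_keys_iff subset_iff not_less) (metis linorder_not_le)

lemma subspace_Rn: "subspace (Rn n)"
  by (auto simp: subspace_def Rn_eq lookup_add)

lemma single_in_Rn: "i < n \<Longrightarrow> Poly_Mapping.single i c \<in> Rn n"
  by (auto simp: Rn_eq lookup_single when_def)

lemma Rn_expansion:
  assumes "x \<in> Rn n"
  shows "x = (\<Sum>i<n. Poly_Mapping.lookup x i *\<^sub>R Poly_Mapping.single i 1)"
proof (rule poly_mapping_eqI)
  fix k
  show "Poly_Mapping.lookup x k =
      Poly_Mapping.lookup (\<Sum>i<n. Poly_Mapping.lookup x i *\<^sub>R Poly_Mapping.single i 1) k"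
    using assms
    by (cases "k < n") (auto simp: lookup_sum lookup_single when_def Rn_eq if_distrib cong: if_cong)
qed

text \<open>The coefficients of \<open>g\<close> are the values of \<open>G\<close> on the unit
  vectors. This turns the derivative of a norm into a normal vector, as
  \<open>supporting_hyperplane\<close> requires.\<close>

lemma linear_functional_dot:
  fixes G :: "(nat \<Rightarrow>\<^sub>0 real) \<Rightarrow> real"
  assumes "linear G"
  obtains g where "g \<in> Rn n" "\<And>z. z \<in> Rn n \<Longrightarrow> dot n g z = G z"
proof -
  define g :: "nat \<Rightarrow>\<^sub>0 real"
    where "g = (\<Sum>i<n. G (Poly_Mapping.single i 1) *\<^sub>R Poly_Mapping.single i 1)"
  have "g \<in> Rn n"
    unfolding g_def
    by (intro subspace_sum[OF subspace_Rn] subspace_mul[OF subspace_Rn] single_in_Rn) auto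
  moreover have "dot n g z = G z" if "z \<in> Rn n" for z
  proof -
    have "G z = (\<Sum>i<n. Poly_Mapping.lookup z i * G (Poly_Mapping.single i 1))"
      by (subst Rn_expansion[OF that]) (simp add: linear_sum[OF assms] linear_cmul[OF assms])
    also have "\<dots> = dot n g z"
      unfolding dot_def
      by (rule sum.cong) (auto simp: g_def lookup_sum lookup_single when_def if_distrib cong: if_cong)
    finally show ?thesis by simp
  qed
  ultimately show thesis using that by blast
qed

lemma dot_add: "dot n a (x + y) = dot n a x + dot n a y"
  by (simp add: dot_def lookup_add algebra_simps sum.distrib)

lemma dot_scaleR: "dot n a (c *\<^sub>R x) = c * dot n a x"
  by (simp add: dot_def algebra_simps sum_distrib_left)

lemma dot_minus_left: "dot n (- a) x = - dot n a x"
  by (simp add: dot_def sum_negf)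

section \<open>Smoothness from directional derivatives\<close>

text \<open>Continuity makes the ball relatively closed and its part with \<open>N x < 1\<close>
  relatively open, so that part lies in the interior.\<close>

lemma frontier_unit_ball:
  assumes "continuous_on (Rn n) N" "p \<in> top_of_set (Rn n) frontier_of {x \<in> Rn n. N x \<le> (1::real)}"
  shows "p \<in> Rn n" "N p = 1"
proof -
  let ?T = "top_of_set (Rn n)" and ?K = "{x \<in> Rn n. N x \<le> 1}"
  have "closedin ?T (Rn n \<inter> N -` {..1})"
    using assms(1) by (rule continuous_closedin_preimage) simp
  then have "closedin ?T ?K"
    by (simp add: vimage_def Int_def)
  then have p: "p \<in> ?K"
    using assms(2) by (auto simp: frontier_of_def closure_of_closedin)
  have "openin ?T (Rn n \<inter> N -` {..<1})"
    using assms(1) by (rule continuous_openin_preimage_gen) simp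
  then have "Rn n \<inter> N -` {..<1} \<subseteq> ?T interior_of ?K"
    by (intro interior_of_maximal) auto
  with assms(2) have "p \<notin> Rn n \<inter> N -` {..<1}"
    by (auto simp: frontier_of_def)
  with p show "p \<in> Rn n" "N p = 1"
    by auto
qed

text \<open>The directional derivatives at \<open>p\<close> form a linear functional, which supplies
  one supporting hyperplane. Any supporting functional touches a multiple of \<open>N\<close> from
  below at \<open>p\<close>, so it must agree with that multiple of the derivative.\<close>

lemma smooth_normI:
  assumes N: "norm_on n N" and cont: "continuous_on (Rn n) N"
    and grad: "\<And>p. p \<in> Rn n \<Longrightarrow> N p = 1 \<Longrightarrow> \<exists>g\<in>Rn n. \<forall>z\<in>Rn n.
      ((\<lambda>t. N (p + t *\<^sub>R z)) has_real_derivative dot n g z) (at 0)"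
  shows "smooth_norm n N"
proof -
  let ?K = "{x \<in> Rn n. N x \<le> 1}"
  have "\<exists>!H. supporting_hyperplane n ?K p H" if "p \<in> top_of_set (Rn n) frontier_of ?K" for p
  proof -
    have p: "p \<in> Rn n" "N p = 1"
      using frontier_unit_ball[OF cont that] by auto
    obtain g where g: "g \<in> Rn n"
      and der: "\<And>z. z \<in> Rn n \<Longrightarrow>
        ((\<lambda>t. N (p + t *\<^sub>R z)) has_real_derivative dot n g z) (at 0)"
      using grad[OF p] by blast
    have line: "p + t *\<^sub>R z \<in> Rn n" if "z \<in> Rn n" for t z
      using p(1) that by (intro subspace_add[OF subspace_Rn] subspace_mul[OF subspace_Rn])
    \<comment> \<open>Euler's relation: along the ray through \<open>p\<close>, homogeneity gives |1
      + t|, which has slope 1 at \<open>t = 0\<close>.\<close>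
    have gp: "dot n g p = 1"
    proof -
      have "N (p + t *\<^sub>R p) = \<bar>1 + t\<bar>" for t
      proof -
        have "p + t *\<^sub>R p = (1 + t) *\<^sub>R p"
          by (simp add: scaleR_add_left)
        then show ?thesis
          using N p by (simp add: norm_on_def)
      qed
      moreover have "((\<lambda>t. \<bar>1 + t\<bar>) has_real_derivative 1) (at 0)"
      proof (rule has_field_derivative_transform_within_open[where S = "{-1<..}"])
        show "((\<lambda>t. 1 + t) has_real_derivative 1) (at 0)"
          by (auto intro!: derivative_eq_intros)
      qed auto
      ultimately have "((\<lambda>t. N (p + t *\<^sub>R p)) has_real_derivative 1) (at 0)"
        by simp
      then show ?thesis
        using DERIV_unique der[OF p(1)] by blast
    qed
    \<comment> \<open>If \<open>dot n g x\<close> exceeded 1, \<open>N\<close> would rise above 1 on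
      the segment from \<open>p\<close> towards \<open>x\<close>, contrary to the convexity of the
      ball.\<close>
    have below: "dot n g x \<le> 1" if x: "x \<in> ?K" for x
    proof (rule ccontr)
      assume "\<not> dot n g x \<le> 1"
      moreover have z: "x - p \<in> Rn n"
        using x p by (auto intro: subspace_diff[OF subspace_Rn])
      moreover have "dot n g (x - p) = dot n g x - 1"
        using dot_add[of n g "x - p" p] gp by simp
      ultimately have "0 < dot n g (x - p)" by simp
      from DERIV_pos_inc_right[OF der[OF z] this] obtain d where d: "d > 0"
        "\<And>h. 0 < h \<Longrightarrow> h < d \<Longrightarrow> 1 < N (p + h *\<^sub>R (x - p))"
        using p by auto
      \<comment> \<open>Below \<open>d\<close> the derivative forces \<open>N\<close> above 1; at
        most 1 keeps the point on the segment.\<close>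
      define h where "h = min (d / 2) 1"
      have h: "0 < h" "h < d" "h \<le> 1"
        using d(1) by (auto simp: h_def)
      have "p + h *\<^sub>R (x - p) = (1 - h) *\<^sub>R p + h *\<^sub>R x"
        by (simp add: algebra_simps)
      also have "N \<dots> \<le> N ((1 - h) *\<^sub>R p) + N (h *\<^sub>R x)"
      proof -
        have "(1 - h) *\<^sub>R p \<in> Rn n" "h *\<^sub>R x \<in> Rn n"
          using x p by (auto intro: subspace_mul[OF subspace_Rn])
        then show ?thesis
          using N by (simp add: norm_on_def)
      qed
      also have "\<dots> = (1 - h) * N p + h * N x"
        using N x p h by (auto simp: norm_on_def)
      also have "\<dots> \<le> (1 - h) * 1 + h * 1"
        using x p h by (intro add_mono mult_left_mono) auto
      finally show False
        using d(2)[OF h(1,2)] by simp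
    qed
    have "supporting_hyperplane n ?K p {x \<in> Rn n. dot n g x = 1}"
    proof -
      have "g \<noteq> 0"
        using gp by (auto simp: dot_def)
      then show ?thesis
        unfolding supporting_hyperplane_def
        using g gp p below by (intro exI[of _ g] exI[of _ 1]) auto
    qed
    moreover have "H = {x \<in> Rn n. dot n g x = 1}" if "supporting_hyperplane n ?K p H" for H
    proof -
      \<comment> \<open>Negating \<open>a\<close> and \<open>c\<close> reduces the second choice of
        halfspace to the first.\<close>
      obtain a c where ac: "a \<in> Rn n" "a \<noteq> 0" "H = {x \<in> Rn n. dot n a x = c}" "dot n a p = c"
        "?K \<subseteq> {x \<in> Rn n. dot n a x \<le> c}"
      proof -
        obtain a c where ac: "a \<in> Rn n" "a \<noteq> 0" "H = {x \<in> Rn n. dot n a x = c}" "dot n a p = c"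
          and "?K \<subseteq> {x \<in> Rn n. dot n a x \<le> c} \<or> ?K \<subseteq> {x \<in> Rn n. dot n a x \<ge> c}"
          using \<open>supporting_hyperplane n ?K p H\<close> by (auto simp: supporting_hyperplane_def)
        then consider "?K \<subseteq> {x \<in> Rn n. dot n a x \<le> c}" | "?K \<subseteq> {x \<in> Rn n. dot n a x \<ge> c}"
          by blast
        then show thesis
        proof cases
          case 1
          then show ?thesis using that ac by blast
        next
          case 2
          then show ?thesis
            using ac by (intro that[of "- a" "- c"])
              (auto simp: dot_minus_left subspace_neg[OF subspace_Rn])
        qed
      qed
      \<comment> \<open>Homogeneity extends the bound from the ball to all of
        \<open>Rn n\<close>.\<close>
      have a_le: "dot n a x \<le> c * N x" if "x \<in> Rn n" for x
      proof (cases "x = 0")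
        case True
        then have "N x = 0"
          using N that by (simp add: norm_on_def)
        with True show ?thesis
          by (simp add: dot_def)
      next
        case False
        then have "N x > 0"
          using N that by (metis norm_on_def order_less_le)
        then have "inverse (N x) *\<^sub>R x \<in> ?K"
          using N that by (auto simp: norm_on_def subspace_mul[OF subspace_Rn])
        then have "inverse (N x) * dot n a x \<le> c"
          using ac(5) by (auto simp: dot_scaleR)
        then show ?thesis
          using \<open>N x > 0\<close> by (simp add: field_simps)
      qed
      have az: "dot n a z = c * dot n g z" if z: "z \<in> Rn n" for z
      proof -
        \<comment> \<open>this nonnegative function of \<open>t\<close> vanishes at 0, so its derivative there is zero\<close>
        let ?h = "\<lambda>t. c * N (p + t *\<^sub>R z) - (c + t * dot n a z)"
        have "(?h has_real_derivative c * dot n g z - dot n a z) (at 0)"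
          by (rule derivative_eq_intros der[OF z] refl | simp)+
        moreover have "?h 0 \<le> ?h t" for t
          using a_le[OF line[OF z, of t]] p ac(4) by (simp add: dot_add dot_scaleR)
        ultimately have "c * dot n g z - dot n a z = 0"
          by (intro DERIV_local_min[of ?h _ 0 1]) auto
        then show ?thesis by simp
      qed
      have "c \<noteq> 0"
      proof
        assume "c = 0"
        then have "Poly_Mapping.lookup a i = 0" if "i < n" for i
        proof -
          have "dot n a (Poly_Mapping.single i 1) = Poly_Mapping.lookup a i"
            using that by (simp add: dot_def lookup_single when_def mult_delta_right)
          then show ?thesis
            using az[OF single_in_Rn[OF that, of 1]] \<open>c = 0\<close> by simp
        qed
        then have "a = 0"
          using ac(1) by (intro poly_mapping_eqI) (metis (mono_tags) Rn_eq lookup_zero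
              linorder_not_le mem_Collect_eq)
        with ac(2) show False ..
      qed
      then have "dot n a x = c \<longleftrightarrow> dot n g x = 1" if "x \<in> Rn n" for x
        using az[OF that] by simp
      then show ?thesis
        unfolding ac(3) by blast
    qed
    ultimately show ?thesis by blast
  qed
  with N show ?thesis
    by (simp add: smooth_norm_def)
qed

section \<open>Sums of two norms pulled back from an inner product space\<close>

context
  fixes n :: nat and A B :: "(nat \<Rightarrow>\<^sub>0 real) \<Rightarrow> 'a::real_inner" and N :: "(nat \<Rightarrow>\<^sub>0 real) \<Rightarrow> real"
  assumes A: "bounded_linear A" and B: "bounded_linear B"
    and A0: "\<And>x. x \<in> Rn n \<Longrightarrow> A x = 0 \<Longrightarrow> x = 0"
    and B0: "\<And>x. x \<in> Rn n \<Longrightarrow> B x = 0 \<Longrightarrow> x = 0"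
    and N_def: "N = (\<lambda>x. norm (A x) + norm (B x))"
begin

interpretation A: bounded_linear A by (rule A)
interpretation B: bounded_linear B by (rule B)

lemma norm_on_sum_norms: "norm_on n N"
proof -
  have "norm (A (x + y)) + norm (B (x + y)) \<le> norm (A x) + norm (B x) + (norm (A y) + norm (B y))"
    for x y
    using norm_triangle_ineq[of "A x" "A y"] norm_triangle_ineq[of "B x" "B y"]
    by (simp add: A.add B.add)
  moreover have "norm (A x) + norm (B x) = 0 \<longleftrightarrow> x = 0" if "x \<in> Rn n" for x
    using A0[OF that] by (auto simp: add_nonneg_eq_0_iff A.zero B.zero)
  ultimately show ?thesis
    by (auto simp: norm_on_def N_def A.scaleR B.scaleR algebra_simps)
qed

text \<open>Equality in the triangle inequality for \<open>N\<close> forces equality in the summand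
  of \<open>A\<close>. In an inner product space the two images are then nonnegatively proportional,
  injectivity of \<open>A\<close> on \<open>Rn n\<close> carries this over to \<open>x\<close> and
  \<open>y\<close>, and equal norms leave only \<open>x = y\<close>.\<close>

lemma strictly_convex_sum_norms: "strictly_convex_norm n N"
proof -
  have "N (\<tau> *\<^sub>R x + (1 - \<tau>) *\<^sub>R y) < N x"
    if x: "x \<in> Rn n" and y: "y \<in> Rn n" and t: "0 < \<tau>" "\<tau> < 1" and "x \<noteq> y" and eq: "N x = N y"
    for x y \<tau>
  proof (rule ccontr)
    let ?x = "\<tau> *\<^sub>R x" and ?y = "(1 - \<tau>) *\<^sub>R y"
    assume "\<not> N (?x + ?y) < N x"
    moreover have Nx: "N ?x = \<tau> * N x" and Ny: "N ?y = (1 - \<tau>) * N x"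
      using t eq norm_on_sum_norms x y by (auto simp: norm_on_def)
    \<comment> \<open>As \<open>N x = N y\<close>, the left side is just \<open>N x\<close>, so the
      triangle inequality for \<open>N\<close> is tight.\<close>
    ultimately have "N ?x + N ?y \<le> N (?x + ?y)"
      by (simp add: algebra_simps)
    then have "norm (A ?x + A ?y) = norm (A ?x) + norm (A ?y)"
      using norm_triangle_ineq[of "A ?x" "A ?y"] norm_triangle_ineq[of "B ?x" "B ?y"]
      unfolding N_def A.add B.add by linarith
    then have "norm (A ?x) *\<^sub>R A ?y = norm (A ?y) *\<^sub>R A ?x"
      by (simp add: norm_triangle_eq)
    then have "A (norm (A ?x) *\<^sub>R ?y - norm (A ?y) *\<^sub>R ?x) = 0"
      by (simp add: A.diff A.scaleR)
    moreover have "norm (A ?x) *\<^sub>R ?y - norm (A ?y) *\<^sub>R ?x \<in> Rn n"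
      using x y by (intro subspace_diff[OF subspace_Rn] subspace_mul[OF subspace_Rn])
    ultimately have par: "norm (A ?x) *\<^sub>R ?y = norm (A ?y) *\<^sub>R ?x"
      using A0 by force
    show False
    proof (cases "x = 0")
      case True
      then have "N y = 0"
        using eq norm_on_sum_norms x by (metis norm_on_def)
      then show False
        using True \<open>x \<noteq> y\<close> norm_on_sum_norms y by (metis norm_on_def)
    next
      case False
      then have Ax: "norm (A x) > 0"
        using A0[OF x] by auto
      \<comment> \<open>The factor obtained by solving \<open>par\<close> for \<open>y\<close> as a
        multiple of \<open>x\<close>.\<close>
      define c where "c = norm (A ?y) / (norm (A ?x) * (1 - \<tau>)) * \<tau>"
      have "c \<ge> 0"
        using t by (auto simp: c_def)
      have "y = (1 / (norm (A ?x) * (1 - \<tau>))) *\<^sub>R (norm (A ?x) *\<^sub>R ?y)"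
        using t Ax by (simp add: A.scaleR)
      also have "\<dots> = c *\<^sub>R x"
        unfolding par by (simp add: c_def)
      finally have yc: "y = c *\<^sub>R x" .
      then have "N y = c * N x"
        using norm_on_sum_norms x \<open>c \<ge> 0\<close> by (simp add: norm_on_def)
      moreover have "N x > 0"
        using Ax by (simp add: N_def add_pos_nonneg)
      ultimately have "c = 1"
        using eq by simp
      with yc \<open>x \<noteq> y\<close> show False by simp
    qed
  qed
  then show ?thesis
    using norm_on_sum_norms by (auto simp: strictly_convex_norm_def)
qed

text \<open>An inner product norm is differentiable away from 0, with gradient \<open>sgn\<close>.
  Injectivity of \<open>A\<close> and \<open>B\<close> on \<open>Rn n\<close> keeps both images of a
  point with \<open>N p = 1\<close> away from 0.\<close>

lemma smooth_sum_norms: "smooth_norm n N"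
proof (rule smooth_normI[OF norm_on_sum_norms])
  show "continuous_on (Rn n) N"
    unfolding N_def by (intro continuous_intros A.continuous_on B.continuous_on)
next
  fix p assume p: "p \<in> Rn n" "N p = 1"
  then have "p \<noteq> 0"
    by (auto simp: N_def A.zero B.zero)
  then have nz: "A p \<noteq> 0" "B p \<noteq> 0"
    using A0 B0 p by auto
  define G where "G z = A z \<bullet> sgn (A p) + B z \<bullet> sgn (B p)" for z
  have "linear G"
    by (rule linearI)
      (simp_all add: G_def A.add B.add A.scaleR B.scaleR inner_add_left algebra_simps)
  then obtain g where g: "g \<in> Rn n" "\<And>z. z \<in> Rn n \<Longrightarrow> dot n g z = G z"
    using linear_functional_dot by metis
  have line: "((\<lambda>t. norm (u + t *\<^sub>R v)) has_real_derivative v \<bullet> sgn u) (at 0)"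
    if "u \<noteq> 0" for u v :: 'a
  proof -
    have "((\<lambda>t. u + t *\<^sub>R v) has_derivative (\<lambda>t. t *\<^sub>R v)) (at 0)"
      by (auto intro!: derivative_eq_intros)
    moreover have "(norm has_derivative (\<lambda>h. h \<bullet> sgn u)) (at (u + 0 *\<^sub>R v))"
      using has_derivative_norm[OF that] by simp
    ultimately have "((\<lambda>t. norm (u + t *\<^sub>R v)) has_derivative (\<lambda>t. (t *\<^sub>R v) \<bullet> sgn u)) (at 0)"
      by (rule has_derivative_compose)
    then show ?thesis
      by (rule has_derivative_imp_has_field_derivative) simp
  qed
  have "((\<lambda>t. N (p + t *\<^sub>R z)) has_real_derivative dot n g z) (at 0)" if "z \<in> Rn n" for z
    unfolding N_def g(2)[OF that] G_def A.add B.add A.scaleR B.scaleR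
    using nz by (intro DERIV_add line)
  with g(1) show "\<exists>g\<in>Rn n. \<forall>z\<in>Rn n.
      ((\<lambda>t. N (p + t *\<^sub>R z)) has_real_derivative dot n g z) (at 0)"
    by blast
qed

end

section \<open>A norm on three-space\<close>

definition vec3 :: "real \<Rightarrow> real \<Rightarrow> real \<Rightarrow> (nat \<Rightarrow>\<^sub>0 real)" where
  "vec3 a b c = Poly_Mapping.single 0 a + Poly_Mapping.single 1 b + Poly_Mapping.single 2 c"

lemma lookup_vec3 [simp]:
  "Poly_Mapping.lookup (vec3 a b c) 0 = a"
  "Poly_Mapping.lookup (vec3 a b c) (Suc 0) = b"
  "Poly_Mapping.lookup (vec3 a b c) 2 = c"
  by (simp_all add: vec3_def lookup_add lookup_single)

lemma vec3_in_Rn: "vec3 a b c \<in> Rn 3"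
  by (auto simp: vec3_def intro!: subspace_add[OF subspace_Rn] single_in_Rn)

lemma vec3_diff: "vec3 a b c - vec3 a' b' c' = vec3 (a - a') (b - b') (c - c')"
  by (simp add: vec3_def single_diff)

lemma vec3_eq_iff: "vec3 a b c = vec3 a' b' c' \<longleftrightarrow> a = a' \<and> b = b' \<and> c = c'"
  by (metis lookup_vec3)

lemma vec3_eq_0_iff: "vec3 a b c = 0 \<longleftrightarrow> a = 0 \<and> b = 0 \<and> c = 0"
  using vec3_eq_iff[of a b c 0 0 0] by (simp add: vec3_def)

text \<open>The shear puts the two endpoints of the light path over \<open>0\<close> and
  \<open>h\<close>; the factor 2 gives them different distances from the mirror when
  \<open>r\<close> is nonzero. With equal distances the minimiser would stay at \<open>h / 2\<close>
  for every \<open>r\<close>.\<close>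

definition skew_norm :: "(nat \<Rightarrow>\<^sub>0 real) \<Rightarrow> real" where
  "skew_norm =
    (\<lambda>x. norm (Poly_Mapping.lookup x 0, Poly_Mapping.lookup x 1, Poly_Mapping.lookup x 2) +
      norm (Poly_Mapping.lookup x 0 - Poly_Mapping.lookup x 2,
        2 * Poly_Mapping.lookup x 1, Poly_Mapping.lookup x 2))"

lemma eq_0_if_lookup_lt_3:
  assumes "x \<in> Rn 3" "Poly_Mapping.lookup x 0 = 0" "Poly_Mapping.lookup x (Suc 0) = 0"
    "Poly_Mapping.lookup x 2 = 0"
  shows "x = 0"
proof (rule poly_mapping_eqI)
  fix k :: nat
  consider "k = 0" | "k = Suc 0" | "k = 2" | "k \<ge> 3" by linarith
  then show "Poly_Mapping.lookup x k = Poly_Mapping.lookup 0 k"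
    using assms by cases (auto simp: Rn_eq)
qed

lemma skew_norm_properties:
  "norm_on 3 skew_norm" "strictly_convex_norm 3 skew_norm" "smooth_norm 3 skew_norm"
proof -
  let ?A = "\<lambda>x::nat \<Rightarrow>\<^sub>0 real.
    (Poly_Mapping.lookup x 0, Poly_Mapping.lookup x 1, Poly_Mapping.lookup x 2)"
  let ?B = "\<lambda>x::nat \<Rightarrow>\<^sub>0 real. (Poly_Mapping.lookup x 0 - Poly_Mapping.lookup x 2,
    2 * Poly_Mapping.lookup x 1, Poly_Mapping.lookup x 2)"
  have A: "bounded_linear ?A"
    by (intro bounded_linear_Pair bounded_linear_lookup)
  have B: "bounded_linear ?B"
    by (intro bounded_linear_Pair bounded_linear_lookup bounded_linear_sub
        bounded_linear_const_mult)
  have A0: "\<And>x. x \<in> Rn 3 \<Longrightarrow> ?A x = 0 \<Longrightarrow> x = 0" and B0: "\<And>x. x \<in> Rn 3 \<Longrightarrow> ?B x = 0 \<Longrightarrow> x = 0"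
    by (auto simp: zero_prod_def intro!: eq_0_if_lookup_lt_3)
  note * = A B A0 B0 skew_norm_def
  show "norm_on 3 skew_norm" "strictly_convex_norm 3 skew_norm" "smooth_norm 3 skew_norm"
    by (rule norm_on_sum_norms[OF *] strictly_convex_sum_norms[OF *] smooth_sum_norms[OF *]; simp)+
qed

text \<open>The bracketing separates the squared heights \<open>r\<^sup>2 + h\<^sup>2\<close> and
  \<open>4 * r\<^sup>2 + h\<^sup>2\<close> from the horizontal parts, to match the reflection
  lemmas.\<close>

lemma skew_norm_vec3:
  "skew_norm (vec3 s r h) = sqrt (s\<^sup>2 + (r\<^sup>2 + h\<^sup>2)) + sqrt ((h - s)\<^sup>2 + (4 * r\<^sup>2 + h\<^sup>2))"
  by (simp add: skew_norm_def norm_prod_def power2_commute[of s h] power_mult_distrib)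

text \<open>Central symmetry combined with a sign change of \<open>r\<close>, which enters only
  squared.\<close>

lemma skew_norm_vec3_uminus: "skew_norm (vec3 (- s) r (- h)) = skew_norm (vec3 s r h)"
  by (simp add: skew_norm_vec3 power2_commute[of s h])

section \<open>Minimising along a fibre by the reflection principle\<close>

text \<open>The path from height \<alpha> to the mirror point \<open>s\<close> and on to height
  \<beta> unfolds into the vectors \<open>(s, \<alpha>)\<close> and \<open>(d - s, \<beta>)\<close>,
  whose sum is \<open>(d, \<alpha> + \<beta>)\<close>.\<close>

lemma reflected_path_lower_bound:
  fixes \<alpha> \<beta> d s :: real
  shows "sqrt (d\<^sup>2 + (\<alpha> + \<beta>)\<^sup>2) \<le> sqrt (s\<^sup>2 + \<alpha>\<^sup>2) + sqrt ((d - s)\<^sup>2 + \<beta>\<^sup>2)"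
  using norm_triangle_ineq[of "(s, \<alpha>)" "(d - s, \<beta>)"] by (simp add: norm_prod_def)

text \<open>The unfolded path is straight exactly when its two vectors are parallel, which is the
  law of equal angles; positive heights rule out opposite directions.\<close>

lemma reflected_path_eq_iff:
  fixes \<alpha> \<beta> d s :: real
  assumes "\<alpha> > 0" "\<beta> > 0"
  shows "sqrt (s\<^sup>2 + \<alpha>\<^sup>2) + sqrt ((d - s)\<^sup>2 + \<beta>\<^sup>2) = sqrt (d\<^sup>2 + (\<alpha> + \<beta>)\<^sup>2) \<longleftrightarrow>
    \<alpha> * (d - s) = \<beta> * s"
proof -
  let ?u = "(s, \<alpha>)" and ?w = "(d - s, \<beta>)"
  have "sqrt (s\<^sup>2 + \<alpha>\<^sup>2) + sqrt ((d - s)\<^sup>2 + \<beta>\<^sup>2) = sqrt (d\<^sup>2 + (\<alpha> + \<beta>)\<^sup>2) \<longleftrightarrow>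
      norm (?u + ?w) = norm ?u + norm ?w"
    by (auto simp: norm_prod_def)
  also have "\<dots> \<longleftrightarrow> norm ?u *\<^sub>R ?w = norm ?w *\<^sub>R ?u"
    by (rule norm_triangle_eq)
  also have "\<dots> \<longleftrightarrow> \<alpha> * (d - s) = \<beta> * s"
  proof
    assume "norm ?u *\<^sub>R ?w = norm ?w *\<^sub>R ?u"
    then have *: "norm ?u * (d - s) = norm ?w * s" "norm ?u * \<beta> = norm ?w * \<alpha>"
      by auto
    have "norm ?u > 0"
      using assms by (simp add: prod_eq_iff)
    moreover have "norm ?u * (\<alpha> * (d - s)) = norm ?u * (\<beta> * s)"
      using * by (metis mult.assoc mult.commute)
    ultimately show "\<alpha> * (d - s) = \<beta> * s"
      by simp
  next
    assume *: "\<alpha> * (d - s) = \<beta> * s"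
    then have w: "?w = (\<beta> / \<alpha>) *\<^sub>R ?u"
      using assms by (simp add: field_simps)
    have "norm ?w = \<beta> / \<alpha> * norm ?u"
      unfolding w using assms by (simp only: norm_scaleR) simp
    then show "norm ?u *\<^sub>R ?w = norm ?w *\<^sub>R ?u"
      unfolding w by simp
  qed
  finally show ?thesis .
qed

text \<open>The minimum of \<open>skew_norm (vec3 s r h)\<close> over \<open>s\<close>.\<close>

definition fibre_min :: "real \<Rightarrow> real \<Rightarrow> real" where
  "fibre_min r h = sqrt (h\<^sup>2 + (sqrt (r\<^sup>2 + h\<^sup>2) + sqrt (4 * r\<^sup>2 + h\<^sup>2))\<^sup>2)"

text \<open>For fixed \<open>r\<close> and \<open>h\<close>, \<open>skew_norm\<close> is the length
  of a reflected path with horizontal displacement \<open>h\<close> and the two square roots as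
  heights.\<close>

lemma fibre_min_le: "fibre_min r h \<le> skew_norm (vec3 s r h)"
  using reflected_path_lower_bound[of h "sqrt (r\<^sup>2 + h\<^sup>2)" "sqrt (4 * r\<^sup>2 + h\<^sup>2)" s]
  by (simp add: fibre_min_def skew_norm_vec3)

text \<open>For nonzero \<open>h\<close> both heights are positive. The resulting condition is
  linear in \<open>s\<close>, so it singles out one minimiser.\<close>

lemma skew_norm_eq_fibre_min_iff:
  assumes "h \<noteq> 0"
  shows "skew_norm (vec3 s r h) = fibre_min r h \<longleftrightarrow>
    sqrt (r\<^sup>2 + h\<^sup>2) * (h - s) = sqrt (4 * r\<^sup>2 + h\<^sup>2) * s"
  using reflected_path_eq_iff[of "sqrt (r\<^sup>2 + h\<^sup>2)" "sqrt (4 * r\<^sup>2 + h\<^sup>2)" s h] assms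
  by (simp add: fibre_min_def skew_norm_vec3 add_nonneg_pos)

text \<open>Both heights grow strictly as soon as one of \<open>r\<^sup>2\<close> and
  \<open>h\<^sup>2\<close> does. This disposes of lattice vectors that move a point to a fibre with
  larger |r| or |h|.\<close>

lemma fibre_min_less:
  assumes "r\<^sup>2 \<le> r'\<^sup>2" "h\<^sup>2 \<le> h'\<^sup>2" "r\<^sup>2 < r'\<^sup>2 \<or> h\<^sup>2 < h'\<^sup>2"
  shows "fibre_min r h < fibre_min r' h'"
proof -
  have "sqrt (r\<^sup>2 + h\<^sup>2) + sqrt (4 * r\<^sup>2 + h\<^sup>2) < sqrt (r'\<^sup>2 + h'\<^sup>2) + sqrt (4 * r'\<^sup>2 + h'\<^sup>2)"
    using assms by (intro add_strict_mono) auto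
  then have "(sqrt (r\<^sup>2 + h\<^sup>2) + sqrt (4 * r\<^sup>2 + h\<^sup>2))\<^sup>2
      < (sqrt (r'\<^sup>2 + h'\<^sup>2) + sqrt (4 * r'\<^sup>2 + h'\<^sup>2))\<^sup>2"
    by (intro power_strict_mono) auto
  then show ?thesis
    using assms(2) by (simp add: fibre_min_def)
qed

section \<open>The refined lattices\<close>

definition fine_lattice :: "real \<Rightarrow> (nat \<Rightarrow>\<^sub>0 real) set" where
  "fine_lattice m = {vec3 (of_int a / m) (of_int k) (of_int l) | a k l. True}"

lemma fine_latticeE:
  assumes "x \<in> fine_lattice m"
  obtains a k l where "x = vec3 (of_int a / m) (of_int k) (of_int l)"
  using assms by (auto simp: fine_lattice_def)

lemma fine_latticeI: "vec3 (of_int a / m) (of_int k) (of_int l) \<in> fine_lattice m"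
  by (auto simp: fine_lattice_def)

lemma full_rank_fine_lattice:
  assumes "m \<ge> 1"
  shows "full_rank_lattice 3 (fine_lattice m)"
proof -
  have "0 \<in> fine_lattice m"
    using fine_latticeI[of 0 m 0 0] vec3_eq_0_iff[of 0 0 0] by simp
  moreover have "x - y \<in> fine_lattice m" if "x \<in> fine_lattice m" "y \<in> fine_lattice m" for x y
    using that
  proof (elim fine_latticeE)
    fix a k l a' k' l'
    assume "x = vec3 (of_int a / m) (of_int k) (of_int l)"
      "y = vec3 (of_int a' / m) (of_int k') (of_int l')"
    then show ?thesis
      using fine_latticeI[of "a - a'" m "k - k'" "l - l'"]
      by (simp add: vec3_diff diff_divide_distrib)
  qed
  moreover have "discrete (fine_lattice m)"
  proof (rule uniform_discrete_imp_discrete)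
    \<comment> \<open>The separation \<open>1 / m\<close> is the spacing of the first coordinate
      and, since \<open>m \<ge> 1\<close>, at most that of the other two.\<close>
    have "x = y" if xy: "x \<in> fine_lattice m" "y \<in> fine_lattice m" "dist x y < 1 / m" for x y
    proof -
      have eq: "i = j" if "\<bar>of_int i - of_int j :: real\<bar> < 1" for i j :: int
        using that by linarith
      obtain a k l where x: "x = vec3 (of_int a / m) (of_int k) (of_int l)"
        using xy(1) by (rule fine_latticeE)
      obtain a' k' l' where y: "y = vec3 (of_int a' / m) (of_int k') (of_int l')"
        using xy(2) by (rule fine_latticeE)
      have small: "\<bar>Poly_Mapping.lookup (x - y) i\<bar> < 1 / m" for i
        using norm_lookup_le[of "x - y" i] xy(3) by (simp add: dist_norm)
      have "1 / m \<le> 1"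
        using assms by simp
      then have "k = k'" "l = l'"
        using small[of 1] small[of 2] by (auto simp: x y lookup_minus intro!: eq)
      moreover have "\<bar>(of_int a - of_int a') / m\<bar> < 1 / m"
        using small[of 0] by (simp add: x y lookup_minus diff_divide_distrib)
      then have "a = a'"
        using assms by (intro eq) (simp add: abs_divide divide_less_cancel)
      ultimately show ?thesis
        by (simp add: x y)
    qed
    then show "uniform_discrete (fine_lattice m)"
      using assms unfolding uniform_discrete_def by (intro exI[of _ "1 / m"]) auto
  qed
  moreover have "span (fine_lattice m) = Rn 3"
  proof
    show "span (fine_lattice m) \<subseteq> Rn 3"
      by (rule span_minimal[OF _ subspace_Rn]) (auto simp: fine_lattice_def vec3_in_Rn)
    have "Poly_Mapping.single i 1 \<in> span (fine_lattice m)" if "i < 3" for i :: nat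
    proof -
      consider "i = 0" | "i = 1" | "i = 2"
        using \<open>i < 3\<close> by linarith
      then show ?thesis
      proof cases
        case 1
        have "Poly_Mapping.single 0 1 = m *\<^sub>R vec3 (of_int 1 / m) (of_int 0) (of_int 0)"
          using assms by (intro poly_mapping_eqI) 
            (simp add: vec3_def lookup_add lookup_single when_def del: single_one)
        then show ?thesis
          unfolding 1 by (metis fine_latticeI span_base span_mul)
      next
        case 2
        have "Poly_Mapping.single 1 1 = vec3 (of_int 0 / m) (of_int 1) (of_int 0)"
          by (simp add: vec3_def)
        then show ?thesis
          unfolding 2 by (metis fine_latticeI span_base)
      next
        case 3
        have "Poly_Mapping.single 2 1 = vec3 (of_int 0 / m) (of_int 0) (of_int 1)"
          by (simp add: vec3_def)
        then show ?thesis
          unfolding 3 by (metis fine_latticeI span_base)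
      qed
    qed
    then show "Rn 3 \<subseteq> span (fine_lattice m)"
      by (subst subsetI, subst Rn_expansion) (auto intro!: span_sum span_mul)
  qed
  ultimately show ?thesis
    by (simp add: full_rank_lattice_def)
qed

section \<open>Voronoi-relevant vectors from fibre minimisers\<close>

text \<open>0 is a nearest integer to \<open>r\<close>. This supplies the weak inequalities for
  \<open>fibre_min_less\<close>, also at \<open>1 / 2\<close>, where 0 and 1 tie.\<close>

lemma sq_le_sq_shift_int:
  fixes r :: real
  assumes "\<bar>r\<bar> \<le> 1 / 2"
  shows "r\<^sup>2 \<le> (r - of_int k)\<^sup>2"
proof -
  have "k = 0 \<or> \<bar>of_int k :: real\<bar> \<ge> 1" by linarith
  then have "\<bar>r\<bar> \<le> \<bar>r - of_int k\<bar>"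
    using assms by (auto simp: abs_if split: if_splits)
  then show ?thesis
    by (rule abs_le_square_iff[THEN iffD1])
qed

text \<open>Subtracting \<open>w\<close> moves \<open>x\<close>, the minimiser of its fibre, to the
  fibre \<open>(r - k, 1 / 2 - l)\<close>. Either that fibre has a larger minimum, or
  \<open>k = 0\<close> and \<open>l\<close> is 0 or 1; then it is the fibre of \<open>x\<close> up
  to symmetry, and uniqueness of the minimiser leaves only \<open>0\<close> and
  \<open>v\<close>.\<close>

lemma Voronoi_relevant_fine_lattice:
  assumes m: "m \<ge> 1" and r: "0 \<le> r" "r \<le> 1 / 4"
    and s: "s = of_int b / (2 * m)"
      "sqrt (r\<^sup>2 + (1 / 2)\<^sup>2) * (1 / 2 - s) = sqrt (4 * r\<^sup>2 + (1 / 2)\<^sup>2) * s"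
  shows "Voronoi_relevant 3 skew_norm (fine_lattice m) (vec3 (of_int b / m) 0 1)"
proof -
  define v x where "v = vec3 (of_int b / m) 0 1" and "x = vec3 s r (1 / 2)"
  have v: "v \<in> fine_lattice m - {0}"
    using fine_latticeI[of b m 0 1] by (simp add: v_def vec3_eq_0_iff)
  have Nx: "skew_norm x = fibre_min r (1 / 2)"
    using skew_norm_eq_fibre_min_iff[of "1 / 2" s r] s(2) by (simp add: x_def)
  have b: "of_int b / m = 2 * s"
    using m by (simp add: s(1))
  have "x - v = vec3 (- s) r (- (1 / 2))"
    by (simp add: x_def v_def vec3_diff b)
  then have Nxv: "skew_norm (x - v) = skew_norm x"
    unfolding x_def by (simp only: skew_norm_vec3_uminus)
  have other: "fibre_min r (1 / 2) < skew_norm (vec3 s' r (1 / 2))" if "s' \<noteq> s" for s'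
  proof -
    have "sqrt (r\<^sup>2 + (1 / 2)\<^sup>2) * (1 / 2 - s') \<noteq> sqrt (4 * r\<^sup>2 + (1 / 2)\<^sup>2) * s'"
    proof
      assume "sqrt (r\<^sup>2 + (1 / 2)\<^sup>2) * (1 / 2 - s') = sqrt (4 * r\<^sup>2 + (1 / 2)\<^sup>2) * s'"
      \<comment> \<open>Subtracting the two stationarity equations leaves a positive factor times
        \<open>s' - s\<close>.\<close>
      with s(2) have "(sqrt (r\<^sup>2 + (1 / 2)\<^sup>2) + sqrt (4 * r\<^sup>2 + (1 / 2)\<^sup>2)) * (s' - s) = 0"
        by (simp add: algebra_simps)
      moreover have "sqrt (r\<^sup>2 + (1 / 2)\<^sup>2) + sqrt (4 * r\<^sup>2 + (1 / 2)\<^sup>2) > 0"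
        by (intro add_pos_pos real_sqrt_gt_zero add_nonneg_pos) auto
      ultimately show False
        using that by simp
    qed
    then show ?thesis
      using fibre_min_le[of r "1 / 2" s'] skew_norm_eq_fibre_min_iff[of "1 / 2" s' r] by fastforce
  qed
  have "skew_norm (x - v) < skew_norm (x - w)" if w': "w \<in> fine_lattice m - {0, v}" for w
  proof -
    obtain a k l where w: "w = vec3 (of_int a / m) (of_int k) (of_int l)"
      using w' by (auto elim: fine_latticeE)
    have xw: "x - w = vec3 (s - of_int a / m) (r - of_int k) (1 / 2 - of_int l)"
      by (simp add: x_def w vec3_diff)
    have "fibre_min r (1 / 2) < skew_norm (x - w)"
    proof (cases "k = 0 \<and> (l = 0 \<or> l = 1)")
      case True
      then have "k = 0 \<and> l = 0 \<and> a \<noteq> 0 \<or> k = 0 \<and> l = 1 \<and> a \<noteq> b"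
        using w' by (auto simp: w v_def vec3_eq_0_iff)
      then consider "k = 0" "l = 0" "a \<noteq> 0" | "k = 0" "l = 1" "a \<noteq> b"
        by blast
      then show ?thesis
      proof cases
        case 1
        then show ?thesis
          using other[of "s - of_int a / m"] m by (simp add: xw)
      next
        case 2
        \<comment> \<open>For \<open>l = 1\<close> the symmetry brings \<open>x - w\<close> back to
          the fibre of \<open>x\<close>, at position \<open>a / m - s\<close>, which is
          \<open>s\<close> only for \<open>a = b\<close>.\<close>
        have "s \<noteq> of_int a / m - s"
        proof
          assume "s = of_int a / m - s"
          then have "of_int a / m = of_int b / m"
            using b by linarith
          with 2(3) m show False by simp
        qed
        moreover have "x - w = vec3 (- (of_int a / m - s)) r (- (1 / 2))"
          using 2 by (simp add: xw)
        ultimately show ?thesis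
          using other[of "of_int a / m - s"] by (metis skew_norm_vec3_uminus)
      qed
    next
      case False
      \<comment> \<open>The bound \<open>r \<le> 1 / 4\<close> makes this strict: at
        \<open>r = 1 / 2\<close> the integer 1 would tie with 0.\<close>
      have "r\<^sup>2 < (r - of_int k)\<^sup>2" if "k \<noteq> 0"
      proof -
        have "\<bar>of_int k :: real\<bar> \<ge> 1"
          using that by linarith
        then have "\<bar>r\<bar> < \<bar>r - of_int k\<bar>"
          using r by linarith
        then show ?thesis
          by (metis abs_le_square_iff linorder_not_le)
      qed
      \<comment> \<open>0 and 1 are the two integers nearest to \<open>1 / 2\<close>; all others are
        at least \<open>3 / 2\<close> away.\<close>
      moreover have "(1 / 2)\<^sup>2 < (1 / 2 - of_int l :: real)\<^sup>2" if "l \<noteq> 0" "l \<noteq> 1"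
      proof -
        have "(of_int l :: real) \<le> - 1 \<or> (of_int l :: real) \<ge> 2"
          using that by linarith
        then have "\<bar>1 / 2 :: real\<bar> < \<bar>1 / 2 - of_int l\<bar>"
          by linarith
        then show ?thesis
          by (metis abs_le_square_iff linorder_not_le)
      qed
      ultimately have "fibre_min r (1 / 2) < fibre_min (r - of_int k) (1 / 2 - of_int l)"
        using False r sq_le_sq_shift_int[of r k] sq_le_sq_shift_int[of "1 / 2" l]
        by (intro fibre_min_less) auto
      also have "\<dots> \<le> skew_norm (x - w)"
        unfolding xw by (rule fibre_min_le)
      finally show ?thesis .
    qed
    then show ?thesis
      by (simp add: Nxv Nx)
  qed
  then show ?thesis
    unfolding Voronoi_relevant_def v_def[symmetric]
    using v Nxv vec3_in_Rn[of s r "1 / 2"] x_def by (intro conjI bexI[of _ x]) auto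
qed

section \<open>An interval of minimisers and the count of relevant vectors\<close>

text \<open>At height \<open>h = 1 / 2\<close> the minimiser is \<open>1 / 4\<close> for
  \<open>r = 0\<close> and about 0.221 for \<open>r = 1 / 4\<close>. By the intermediate value
  theorem every value in between is attained; \<open>23 / 100\<close> is a convenient bound inside
  that range.\<close>

lemma stationary_point_exists:
  fixes s :: real
  assumes "23 / 100 \<le> s" "s \<le> 1 / 4"
  obtains r where "0 \<le> r" "r \<le> 1 / 4"
    "sqrt (r\<^sup>2 + (1 / 2)\<^sup>2) * (1 / 2 - s) = sqrt (4 * r\<^sup>2 + (1 / 2)\<^sup>2) * s"
proof -
  define f where "f r = sqrt (r\<^sup>2 + (1 / 2)\<^sup>2) * (1 / 2 - s) - sqrt (4 * r\<^sup>2 + (1 / 2)\<^sup>2) * s" for r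
  have "f (1 / 4) \<le> 0"
  proof -
    \<comment> \<open>\<open>27 / 100\<close> is \<open>1 / 2 - 23 / 100\<close>, and the comparison
      comes down to 5 * 729 \<le> 8 * 529.\<close>
    have "sqrt 5 * (1 / 2 - s) \<le> sqrt 5 * (27 / 100)"
      using assms by (intro mult_left_mono) auto
    also have "\<dots> = sqrt (5 * (27 / 100)\<^sup>2)"
      by (simp add: real_sqrt_mult)
    also have "\<dots> \<le> sqrt (8 * (23 / 100)\<^sup>2)"
      by (intro real_sqrt_le_mono) (simp add: power2_eq_square)
    also have "\<dots> = sqrt 8 * (23 / 100)"
      by (simp add: real_sqrt_mult)
    also have "\<dots> \<le> sqrt 8 * s"
      using assms by (intro mult_left_mono) auto
    finally have *: "sqrt 5 * (1 / 2 - s) \<le> sqrt 8 * s" .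
    have "sqrt ((1 / 4)\<^sup>2 + (1 / 2)\<^sup>2) = sqrt (5 / 4\<^sup>2)" "sqrt (4 * (1 / 4)\<^sup>2 + (1 / 2)\<^sup>2) = sqrt (8 / 4\<^sup>2)"
      by (simp_all add: power2_eq_square)
    then have "sqrt ((1 / 4)\<^sup>2 + (1 / 2)\<^sup>2) = sqrt 5 / 4" "sqrt (4 * (1 / 4)\<^sup>2 + (1 / 2)\<^sup>2) = sqrt 8 / 4"
      unfolding real_sqrt_divide by simp_all
    then have "f (1 / 4) = (sqrt 5 * (1 / 2 - s) - sqrt 8 * s) / 4"
      unfolding f_def by (metis diff_divide_distrib times_divide_eq_left)
    with * show ?thesis by simp
  qed
  moreover have "0 \<le> f 0"
    using assms by (simp add: f_def)
  moreover have "continuous_on {0..1 / 4} f"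
    unfolding f_def by (intro continuous_intros)
  ultimately obtain r where "0 \<le> r" "r \<le> 1 / 4" "f r = 0"
    using IVT2'[of f "1 / 4" 0 0] by auto
  then show thesis
    using that by (simp add: f_def)
qed

theorem corollary8:
  shows "\<not> (\<exists>f :: nat \<Rightarrow> ((nat \<Rightarrow>\<^sub>0 real) \<Rightarrow> real) \<Rightarrow> real.
           \<forall>n N. n \<ge> 3 \<and> norm_on n N \<and> strictly_convex_norm n N \<and> smooth_norm n N \<longrightarrow>
             (\<forall>\<Lambda>. full_rank_lattice n \<Lambda> \<longrightarrow>
                finite {v. Voronoi_relevant n N \<Lambda> v} \<and>
                real (card {v. Voronoi_relevant n N \<Lambda> v}) \<le> f n N))"
proof
  assume "\<exists>f :: nat \<Rightarrow> ((nat \<Rightarrow>\<^sub>0 real) \<Rightarrow> real) \<Rightarrow> real.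
           \<forall>n N. n \<ge> 3 \<and> norm_on n N \<and> strictly_convex_norm n N \<and> smooth_norm n N \<longrightarrow>
             (\<forall>\<Lambda>. full_rank_lattice n \<Lambda> \<longrightarrow>
                finite {v. Voronoi_relevant n N \<Lambda> v} \<and>
                real (card {v. Voronoi_relevant n N \<Lambda> v}) \<le> f n N)"
  then obtain f :: "nat \<Rightarrow> ((nat \<Rightarrow>\<^sub>0 real) \<Rightarrow> real) \<Rightarrow> real" where
    f: "\<And>\<Lambda>. full_rank_lattice 3 \<Lambda> \<Longrightarrow> finite {v. Voronoi_relevant 3 skew_norm \<Lambda> v} \<and>
                real (card {v. Voronoi_relevant 3 skew_norm \<Lambda> v}) \<le> f 3 skew_norm"
    using skew_norm_properties by (metis order_refl)
  \<comment> \<open>The maximum with 1 ensures \<open>K \<ge> 1\<close>, which gives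
    \<open>m \<ge> 1\<close> below.\<close>
  obtain K :: nat where K: "f 3 skew_norm < real K" "K \<ge> 1"
    using reals_Archimedean2[of "max 1 (f 3 skew_norm)"] by force
  \<comment> \<open>With this \<open>m\<close>, \<open>s = b / (100 * K)\<close>, so the range from
    \<open>23 / 100\<close> to \<open>1 / 4\<close> for \<open>s\<close> becomes the range from
    \<open>23 * K\<close> to \<open>25 * K\<close> for \<open>b\<close>, which has
    \<open>2 * K + 1\<close> elements.\<close>
  define m where "m = 50 * real K"
  have m: "m \<ge> 1"
    using K by (simp add: m_def)
  let ?V = "{v. Voronoi_relevant 3 skew_norm (fine_lattice m) v}"
  let ?g = "\<lambda>b::int. vec3 (of_int b / m) 0 1"
  have "?g ` {23 * int K..25 * int K} \<subseteq> ?V"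
  proof (clarify)
    fix b assume b: "b \<in> {23 * int K..25 * int K}"
    define s where "s = of_int b / (2 * m)"
    have "23 * real K \<le> of_int b" "of_int b \<le> 25 * real K"
      using b by (auto simp: of_int_le_iff[symmetric, where 'a = real] simp del: of_int_le_iff)
    then have "23 / 100 \<le> s" "s \<le> 1 / 4"
      using K by (auto simp: s_def m_def field_simps)
    then obtain r where "0 \<le> r" "r \<le> 1 / 4"
      "sqrt (r\<^sup>2 + (1 / 2)\<^sup>2) * (1 / 2 - s) = sqrt (4 * r\<^sup>2 + (1 / 2)\<^sup>2) * s"
      by (rule stationary_point_exists)
    then show "Voronoi_relevant 3 skew_norm (fine_lattice m) (?g b)"
      using Voronoi_relevant_fine_lattice m s_def by blast
  qed
  \<comment> \<open>Finiteness of \<open>?V\<close>, needed to compare cardinalities, is part of the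
    assumption on \<open>f\<close>.\<close>
  then have "card (?g ` {23 * int K..25 * int K}) \<le> card ?V"
    using f[OF full_rank_fine_lattice[OF m]] by (intro card_mono) auto
  moreover have "inj_on ?g {23 * int K..25 * int K}"
    using m by (intro inj_onI) (simp add: vec3_eq_iff)
  then have "card (?g ` {23 * int K..25 * int K}) = card {23 * int K..25 * int K}"
    by (rule card_image)
  ultimately have "K \<le> card ?V"
    by simp
  then show False
    using f[OF full_rank_fine_lattice[OF m]] K by linarith
qed

end
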